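(* Let $n\ge 2$ and let $p(x)=x^n+a_{n-1}x^{n-1}+\dots+a_1x+a_0$ be a monic polynomial with real coefficients and $a_0\neq 0$. Let $\lambda_1,\dots,\lambda_n$ be its complex roots, listed with multiplicity so that $|\lambda_1|\le|\lambda_2|\le\dots\le|\lambda_n|$. Let $C_1$ be the companion matrix of $p$ and $C_2$ the companion matrix of the monic reversal polynomial $q$ of $p$. Then for any (submultiplicative) matrix norm $N$ on the $n\times n$ complex matrices, $$\lim_{k\to\infty}N(C_1^k)^{1/k}=|\lambda_n|\qquad\text{and}\qquad \lim_{k\to\infty}N(C_2^k)^{1/k}=\frac{1}{|\lambda_1|}.$$
   Context: A matrix norm is a norm $N$ on the space of $n\times n$ complex matrices which is submultiplicative: $N(AB)\le N(A)N(B)$. For a monic polynomial $f(x)=x^n+c_{n-1}x^{n-1}+\dots+c_0$, the companion matrix of $f$ is the $n\times n$ matrix with $1$'s on the first subdiagonal, last column $(-c_0,-c_1,\dots,-c_{n-1})^{T}$, and all other entries $0$. For $p(x)=x^n+a_{n-1}x^{n-1}+\dots+a_0$ with $a_0\ne0$, the monic reversal polynomial of $p$ is $q(x)=x^n+\frac{a_1}{a_0}x^{n-1}+\dots+\frac{a_{n-1}}{a_0}x+\frac{1}{a_0}$. *)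

theory Defs
  imports
    Complex_Main
    "HOL-Computational_Algebra.Computational_Algebra"
    "Jordan_Normal_Form.Matrix"
begin

definition matrix_norm :: "nat \<Rightarrow> (complex mat \<Rightarrow> real) \<Rightarrow> bool" where
  "matrix_norm n N \<longleftrightarrow>
     (\<forall>A \<in> carrier_mat n n. 0 \<le> N A) \<and>
     (\<forall>A \<in> carrier_mat n n. N A = 0 \<longleftrightarrow> A = 0\<^sub>m n n) \<and>
     (\<forall>c. \<forall>A \<in> carrier_mat n n. N (c \<cdot>\<^sub>m A) = cmod c * N A) \<and>
     (\<forall>A \<in> carrier_mat n n. \<forall>B \<in> carrier_mat n n. N (A + B) \<le> N A + N B) \<and>
     (\<forall>A \<in> carrier_mat n n. \<forall>B \<in> carrier_mat n n. N (A * B) \<le> N A * N B)"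

text \<open>Intended for monic \<open>f\<close>. Rows and columns are indexed from \<open>0\<close>, so the last column
  has index \<open>degree f - 1\<close>.\<close>

definition companion_mat :: "'a::comm_ring_1 poly \<Rightarrow> 'a mat" where
  "companion_mat f = mat (degree f) (degree f)
     (\<lambda>(i, j). if j = degree f - 1 then - coeff f i else if i = j + 1 then 1 else 0)"

text \<open>\<open>reflect_poly\<close> reverses the coefficient list; the constant term of \<open>p\<close>, assumed nonzero,
  becomes the leading coefficient that is normalised to \<open>1\<close>.\<close>

definition monic_reversal :: "'a::field poly \<Rightarrow> 'a poly" where
  "monic_reversal p = Polynomial.smult (inverse (coeff p 0)) (reflect_poly p)"

lemma monic_reversal_altdef:
  "monic_reversal p = (\<Sum>i\<le>degree p. monom (coeff p i / coeff p 0) (degree p - i))"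
proof (rule poly_eqI)
  fix k
  have "coeff (\<Sum>i\<le>degree p. monom (coeff p i / coeff p 0) (degree p - i)) k =
        (\<Sum>i\<le>degree p. if degree p - i = k then coeff p i / coeff p 0 else 0)"
    by (simp add: coeff_sum)
  also have "\<dots> = (\<Sum>i\<le>degree p. if i = degree p - k \<and> k \<le> degree p
                     then coeff p (degree p - k) / coeff p 0 else 0)"
    by (rule sum.cong) auto
  also have "\<dots> = coeff (monic_reversal p) k"
    by (auto simp: monic_reversal_def coeff_reflect_poly field_simps)
  finally show "coeff (monic_reversal p) k =
      coeff (\<Sum>i\<le>degree p. monom (coeff p i / coeff p 0) (degree p - i)) k" ..
qed

end

theory Submission
  imports Defs "Jordan_Normal_Form.Spectral_Radius"
begin

text \<open>The eigenvalues of a companion matrix are the roots of its polynomial, and reversing the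
  polynomial inverts the roots, so both limits are instances of Gelfand's formula. An eigenvector
  for an eigenvalue \<open>e\<close> gives \<open>N (A ^ k) \<ge> |e| ^ k\<close>. Conversely, for \<open>r\<close> above the spectral radius
  the Jordan normal form bounds the entries of \<open>(A / r) ^ k\<close> uniformly in \<open>k\<close>, hence
  \<open>N (A ^ k) \<le> M * r ^ k\<close>.\<close>

section \<open>Scaling, transposition and the spectrum\<close>

lemma pow_smult_mat:
  fixes A :: "'a::comm_ring_1 mat"
  assumes A: "A \<in> carrier_mat n n"
  shows "(c \<cdot>\<^sub>m A) ^\<^sub>m k = c ^ k \<cdot>\<^sub>m A ^\<^sub>m k"
proof (induction k)
  case 0
  then show ?case using A by auto
next
  case (Suc k)
  have Ak: "A ^\<^sub>m k \<in> carrier_mat n n" using A by simp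
  have "(c \<cdot>\<^sub>m A) ^\<^sub>m Suc k = (c ^ k \<cdot>\<^sub>m A ^\<^sub>m k) * (c \<cdot>\<^sub>m A)"
    using Suc by simp
  also have "\<dots> = c ^ k \<cdot>\<^sub>m (A ^\<^sub>m k * (c \<cdot>\<^sub>m A))"
    using A Ak by (intro mult_smult_assoc_mat) auto
  also have "A ^\<^sub>m k * (c \<cdot>\<^sub>m A) = c \<cdot>\<^sub>m (A ^\<^sub>m k * A)"
    using A Ak by (intro mult_smult_distrib) auto
  finally show ?case by (auto intro!: eq_matI simp: mult_ac)
qed

text \<open>Transposition preserves the characteristic polynomial. This allows companion matrices to
  be studied through their left eigenvectors.\<close>

lemma eigenvalue_transpose_mat:
  fixes A :: "'a::field mat"
  assumes A: "A \<in> carrier_mat n n"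
  shows "eigenvalue A\<^sup>T k \<longleftrightarrow> eigenvalue A k"
  using eigenvalue_root_char_poly[OF A] eigenvalue_root_char_poly[of "A\<^sup>T" n]
    char_poly_transpose_mat[OF A] A by simp

text \<open>An eigenvector of the scaled matrix for \<open>e\<close> is one of \<open>A\<close> for
  \<open>r * e\<close>. Dividing by an \<open>r\<close> above the spectral radius thus yields a
  matrix of spectral radius below 1.\<close>

lemma spectral_radius_inverse_smult:
  assumes A: "A \<in> carrier_mat n n" and n: "n > 0" and r: "r > 0"
  shows "spectral_radius (complex_of_real (inverse r) \<cdot>\<^sub>m A) \<le> spectral_radius A / r"
proof -
  let ?B = "complex_of_real (inverse r) \<cdot>\<^sub>m A"
  have B: "?B \<in> carrier_mat n n" using A by simp
  obtain e where e: "e \<in> spectrum ?B" and sr: "spectral_radius ?B = cmod e"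
    using spectral_radius_mem_max(1)[OF B n] by auto
  obtain v where v: "v \<in> carrier_vec n" "v \<noteq> 0\<^sub>v n" "?B *\<^sub>v v = e \<cdot>\<^sub>v v"
    using e A by (auto simp: spectrum_def eigenvalue_def eigenvector_def)
  have "A *\<^sub>v v = (complex_of_real r * e) \<cdot>\<^sub>v v"
  proof (rule eq_vecI)
    fix i assume i: "i < dim_vec ((complex_of_real r * e) \<cdot>\<^sub>v v)"
    then have i': "i < n" using v by simp
    have "inverse (complex_of_real r) * (A *\<^sub>v v) $ i = (?B *\<^sub>v v) $ i"
      using i' A v(1) by (simp add: scalar_prod_def sum_distrib_left mult.assoc)
    also have "\<dots> = e * v $ i" using i' v by simp
    finally show "(A *\<^sub>v v) $ i = ((complex_of_real r * e) \<cdot>\<^sub>v v) $ i"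
      using i' v(1) r by (simp add: field_simps)
  qed (use A v in auto)
  then have "complex_of_real r * e \<in> spectrum A"
    using A v by (auto simp: spectrum_def eigenvalue_def eigenvector_def)
  then have "cmod (complex_of_real r * e) \<le> spectral_radius A"
    by (intro spectral_radius_mem_max(2)[OF A n]) auto
  then show ?thesis using r sr by (simp add: norm_mult field_simps)
qed

section \<open>Arbitrary matrix norms against entries and eigenvalues\<close>

text \<open>Expand \<open>A\<close> in the matrix units and apply the triangle inequality and
  homogeneity.\<close>

lemma matrix_norm_le_sum_entries:
  assumes N: "matrix_norm n N" and A: "A \<in> carrier_mat n n"
  shows "N A \<le> (\<Sum>ij\<in>{..<n} \<times> {..<n}. cmod (A $$ ij) * N (mat n n (\<lambda>x. if x = ij then 1 else 0)))"
proof -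
  let ?E = "\<lambda>ij. mat n n (\<lambda>x. if x = ij then 1 else (0::complex))"
  \<comment> \<open>The part of \<open>A\<close> supported on the positions in \<open>S\<close>;
    induction on \<open>S\<close> adds one entry at a time until all of \<open>A\<close> is
    reached.\<close>
  let ?R = "\<lambda>S. mat n n (\<lambda>x. if x \<in> S then A $$ x else 0)"
  have triangle: "N (B + C) \<le> N B + N C"
    if "B \<in> carrier_mat n n" "C \<in> carrier_mat n n" for B C
    using N that by (simp add: matrix_norm_def)
  have homogeneous: "N (c \<cdot>\<^sub>m B) = cmod c * N B" if "B \<in> carrier_mat n n" for c B
    using N that by (simp add: matrix_norm_def)
  have "N (?R S) \<le> (\<Sum>ij\<in>S. cmod (A $$ ij) * N (?E ij))" if "finite S" for S
    using that
  proof (induction S)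
    case empty
    have "?R {} = 0\<^sub>m n n" by (auto intro!: eq_matI)
    moreover have "N (0\<^sub>m n n) = 0" using N by (simp add: matrix_norm_def)
    ultimately show ?case by simp
  next
    case (insert ij S)
    have "?R (insert ij S) = A $$ ij \<cdot>\<^sub>m ?E ij + ?R S"
      using insert.hyps by (auto intro!: eq_matI)
    also have "N \<dots> \<le> N (A $$ ij \<cdot>\<^sub>m ?E ij) + N (?R S)"
      by (rule triangle) auto
    also have "N (A $$ ij \<cdot>\<^sub>m ?E ij) = cmod (A $$ ij) * N (?E ij)"
      by (rule homogeneous) auto
    finally show ?case using insert by simp
  qed
  from this[of "{..<n} \<times> {..<n}"]
  have "N (?R ({..<n} \<times> {..<n})) \<le> (\<Sum>ij\<in>{..<n} \<times> {..<n}. cmod (A $$ ij) * N (?E ij))" by simp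
  moreover have "?R ({..<n} \<times> {..<n}) = A" using A by (auto intro!: eq_matI)
  ultimately show ?thesis by simp
qed

text \<open>\<open>K\<close> is the sum of the norms of the matrix units, independent of
  \<open>A\<close> and \<open>b\<close>. A bound on the entries of all powers therefore carries over
  to \<open>N\<close> with a single constant.\<close>

lemma matrix_norm_le_norm_bound:
  assumes N: "matrix_norm n N"
  obtains K where "\<And>A b. A \<in> carrier_mat n n \<Longrightarrow> norm_bound A b \<Longrightarrow> N A \<le> b * K"
proof
  let ?E = "\<lambda>ij. mat n n (\<lambda>x. if x = ij then 1 else (0::complex))"
  let ?K = "\<Sum>ij\<in>{..<n} \<times> {..<n}. N (?E ij)"
  have E: "N (?E ij) \<ge> 0" for ij using N by (simp add: matrix_norm_def)
  fix A :: "complex mat" and b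
  assume A: "A \<in> carrier_mat n n" and b: "norm_bound A b"
  have "N A \<le> (\<Sum>ij\<in>{..<n} \<times> {..<n}. cmod (A $$ ij) * N (?E ij))"
    by (rule matrix_norm_le_sum_entries[OF N A])
  also have "\<dots> \<le> (\<Sum>ij\<in>{..<n} \<times> {..<n}. b * N (?E ij))"
    using b A by (intro sum_mono mult_right_mono E) (auto simp: norm_bound_def)
  finally show "N A \<le> b * ?K" by (simp add: sum_distrib_left)
qed

text \<open>Submultiplicativity gives the bound once the eigenvector is repeated in all columns of a
  square matrix \<open>V\<close>, for then \<open>A V = e V\<close>.\<close>

lemma matrix_norm_ge_eigenvalue:
  assumes N: "matrix_norm n N" and A: "A \<in> carrier_mat n n" and ev: "eigenvector A v e"
  shows "cmod e \<le> N A"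
proof -
  have v: "v \<in> carrier_vec n" "v \<noteq> 0\<^sub>v n" "A *\<^sub>v v = e \<cdot>\<^sub>v v"
    using ev A by (auto simp: eigenvector_def)
  define V where "V = mat n n (\<lambda>(i, j). v $ i)"
  have V: "V \<in> carrier_mat n n" by (simp add: V_def)
  have col: "col V j = v" if "j < n" for j
    using that v(1) by (auto simp: V_def)
  have "A * V = e \<cdot>\<^sub>m V"
  proof (rule eq_matI)
    fix i j assume "i < dim_row (e \<cdot>\<^sub>m V)" "j < dim_col (e \<cdot>\<^sub>m V)"
    then have ij: "i < n" "j < n" using V by auto
    have "(A * V) $$ (i, j) = (A *\<^sub>v v) $ i" using ij A V by (simp add: col)
    also have "\<dots> = (e \<cdot>\<^sub>m V) $$ (i, j)" using ij v by (simp add: V_def)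
    finally show "(A * V) $$ (i, j) = (e \<cdot>\<^sub>m V) $$ (i, j)" .
  qed (use A V in auto)
  then have "cmod e * N V \<le> N A * N V"
    using N A V unfolding matrix_norm_def by metis
  \<comment> \<open>Positivity permits cancelling \<open>N V\<close>; a nonzero entry of
    \<open>v\<close> reappears on the diagonal of \<open>V\<close>.\<close>
  moreover have "N V > 0"
  proof -
    obtain i where "i < n" "v $ i \<noteq> 0" using v by (metis eq_vecI carrier_vecD index_zero_vec)
    then have "V $$ (i, i) \<noteq> 0" by (simp add: V_def)
    then have "V \<noteq> 0\<^sub>m n n" using \<open>i < n\<close> by auto
    then show ?thesis using N V by (auto simp: matrix_norm_def order_less_le)
  qed
  ultimately show ?thesis by simp
qed

section \<open>Gelfand's formula\<close>

theorem gelfand_formula: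
  assumes N: "matrix_norm n N" and A: "A \<in> carrier_mat n n" and n: "n > 0"
  shows "(\<lambda>k. root k (N (A ^\<^sub>m k))) \<longlonglongrightarrow> spectral_radius A"
proof (rule order_tendstoI)
  obtain e where e: "e \<in> spectrum A" and sr: "spectral_radius A = cmod e"
    using spectral_radius_mem_max(1)[OF A n] by auto
  obtain v where v: "eigenvector A v e"
    using e by (auto simp: spectrum_def eigenvalue_def)
  have lower: "cmod e ^ k \<le> N (A ^\<^sub>m k)" for k
  proof -
    have "eigenvector (A ^\<^sub>m k) v (e ^ k)"
      using eigenvector_pow[OF A v, of k] v A by (auto simp: eigenvector_def)
    from matrix_norm_ge_eigenvalue[OF N _ this] A show ?thesis by (simp add: norm_power)
  qed
  fix a assume a: "a < spectral_radius A"
  show "eventually (\<lambda>k. a < root k (N (A ^\<^sub>m k))) sequentially"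
    \<comment> \<open>\<open>root 0\<close> is 0 by convention, so roots are compared only for
      positive \<open>k\<close>.\<close>
    using eventually_gt_at_top[of 0]
  proof eventually_elim
    case (elim k)
    have "cmod e = root k (cmod e ^ k)" using elim by (simp add: real_root_power_cancel)
    also have "\<dots> \<le> root k (N (A ^\<^sub>m k))" using elim lower by simp
    finally show ?case using a sr by simp
  qed
next
  fix a assume a: "a > spectral_radius A"
  have "spectral_radius A \<ge> 0"
    using spectral_radius_mem_max(1)[OF A n] by auto
  \<comment> \<open>The gap between \<open>r\<close> and \<open>a\<close> will absorb the factor
    \<open>root k M\<close>, which tends to 1.\<close>
  obtain r where r: "spectral_radius A < r" "r < a" using a dense by blast
  with \<open>spectral_radius A \<ge> 0\<close> have r0: "r > 0" by simp
  define B where "B = complex_of_real (inverse r) \<cdot>\<^sub>m A"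
  have B: "B \<in> carrier_mat n n" using A by (simp add: B_def)
  have "spectral_radius B < 1"
    using spectral_radius_inverse_smult[OF A n r0] r r0
    by (simp add: B_def) (smt (verit) divide_less_eq_1)
  then obtain c where c: "\<And>k. norm_bound (B ^\<^sub>m k) c"
    using spectral_radius_jnf_norm_bound_less_1_upper_triangular[OF B] by blast
  obtain K where K: "\<And>A b. A \<in> carrier_mat n n \<Longrightarrow> norm_bound A b \<Longrightarrow> N A \<le> b * K"
    using matrix_norm_le_norm_bound[OF N] by metis
  \<comment> \<open>The maximum with 1 secures the positivity required for \<open>root k M\<close>
    to tend to 1.\<close>
  define M where "M = max 1 (c * K)"
  have M: "M > 0" by (simp add: M_def)
  have upper: "N (A ^\<^sub>m k) \<le> M * r ^ k" for k
  proof -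
    have "A = complex_of_real r \<cdot>\<^sub>m B" using r0 A by (auto simp: B_def intro!: eq_matI)
    then have "A ^\<^sub>m k = complex_of_real r ^ k \<cdot>\<^sub>m B ^\<^sub>m k"
      using pow_smult_mat[OF B] by simp
    moreover have "B ^\<^sub>m k \<in> carrier_mat n n" using B by simp
    ultimately have "N (A ^\<^sub>m k) = r ^ k * N (B ^\<^sub>m k)"
      using N r0 by (simp add: matrix_norm_def norm_power)
    also have "N (B ^\<^sub>m k) \<le> M" using K[OF _ c, of k] B by (simp add: M_def)
    finally show ?thesis using r0 by (simp add: mult.commute)
  qed
  have "(\<lambda>k. root k M * r) \<longlonglongrightarrow> 1 * r"
    by (intro tendsto_intros LIMSEQ_root_const M)
  then have "eventually (\<lambda>k. root k M * r < a) sequentially"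
    using r by (intro order_tendstoD(2)) auto
  then show "eventually (\<lambda>k. root k (N (A ^\<^sub>m k)) < a) sequentially"
    using eventually_gt_at_top[of 0]
  proof eventually_elim
    case (elim k)
    have "root k (N (A ^\<^sub>m k)) \<le> root k (M * r ^ k)" using elim upper by simp
    also have "\<dots> = root k M * r"
      using elim r0 by (simp add: real_root_mult real_root_power_cancel)
    finally show ?case using elim by simp
  qed
qed

section \<open>Companion matrices and their eigenvalues\<close>

lemma companion_mat_carrier: "companion_mat f \<in> carrier_mat (degree f) (degree f)"
  by (simp add: companion_mat_def)

text \<open>Every column of the companion matrix but the last is a unit vector, so the transpose
  shifts the entries of \<open>w\<close> and fills the last place from the coefficients.\<close>

lemma index_transpose_companion_mat_mult_vec:
  assumes w: "w \<in> carrier_vec (degree f)" and j: "j < degree f"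
  shows "((companion_mat f)\<^sup>T *\<^sub>v w) $ j =
    (if Suc j = degree f then - (\<Sum>i<degree f. coeff f i * w $ i) else w $ Suc j)"
proof -
  let ?n = "degree f"
  have "((companion_mat f)\<^sup>T *\<^sub>v w) $ j =
      (\<Sum>i<?n. (if j = ?n - 1 then - coeff f i else if i = j + 1 then 1 else 0) * w $ i)"
    using w j by (simp add: companion_mat_def scalar_prod_def atLeast0LessThan)
  also have "\<dots> = (if Suc j = ?n then - (\<Sum>i<?n. coeff f i * w $ i) else w $ Suc j)"
  proof (cases "Suc j = ?n")
    case True
    then have "j = ?n - 1" by simp
    with True show ?thesis by (simp add: sum_negf)
  next
    case False
    with j have "Suc j < ?n" "j \<noteq> ?n - 1" by auto
    then have "(\<Sum>i<?n. (if j = ?n - 1 then - coeff f i else if i = j + 1 then 1 else 0) * w $ i)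
      = (\<Sum>i<?n. if i = Suc j then w $ i else 0)"
      by (intro sum.cong) auto
    with False \<open>Suc j < ?n\<close> show ?thesis by simp
  qed
  finally show ?thesis .
qed

text \<open>The left eigenvectors of the companion matrix are the multiples of \<open>(1, x, \<dots>, x ^ (n - 1))\<close>:
  the subdiagonal forces this shape, and the last column says that \<open>x\<close> is a root.\<close>

lemma eigenvalue_companion_mat:
  fixes f :: "'a::field poly"
  assumes monic: "lead_coeff f = 1" and deg: "degree f > 0"
  shows "eigenvalue (companion_mat f) x \<longleftrightarrow> poly f x = 0"
proof -
  let ?n = "degree f" and ?C = "companion_mat f"
  have poly: "poly f x = (\<Sum>i<?n. coeff f i * x ^ i) + x ^ ?n"
    using monic by (simp add: poly_altdef flip: lessThan_Suc_atMost)
  have "eigenvalue ?C\<^sup>T x \<longleftrightarrow> poly f x = 0"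
  proof
    assume "eigenvalue ?C\<^sup>T x"
    then obtain w where w: "w \<in> carrier_vec ?n" "w \<noteq> 0\<^sub>v ?n" "?C\<^sup>T *\<^sub>v w = x \<cdot>\<^sub>v w"
      using companion_mat_carrier[of f] by (auto simp: eigenvalue_def eigenvector_def)
    have eq: "(if Suc j = ?n then - (\<Sum>i<?n. coeff f i * w $ i) else w $ Suc j) = x * w $ j"
      if "j < ?n" for j
      using index_transpose_companion_mat_mult_vec[OF w(1) that] w that by simp
    have wj: "w $ j = x ^ j * w $ 0" if "j < ?n" for j
      using that
    proof (induction j)
      case (Suc j)
      then show ?case using eq[of j] by simp
    qed simp
    have "w $ 0 \<noteq> 0"
    proof
      assume "w $ 0 = 0"
      then have "w = 0\<^sub>v ?n" using w(1) wj by (intro eq_vecI) auto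
      with w show False by simp
    qed
    \<comment> \<open>The last coordinate of the eigenvector equation; factoring out
      \<open>w $ 0\<close> turns it into \<open>poly f x * w $ 0 = 0\<close>.\<close>
    have "- (\<Sum>i<?n. coeff f i * w $ i) = x * w $ (?n - 1)"
      using eq[of "?n - 1"] deg by simp
    also have "\<dots> = x ^ ?n * w $ 0"
      using wj[of "?n - 1"] deg by (simp add: power_eq_if)
    also have "(\<Sum>i<?n. coeff f i * w $ i) = (\<Sum>i<?n. coeff f i * x ^ i) * w $ 0"
      unfolding sum_distrib_right
    proof (rule sum.cong)
      fix i assume "i \<in> {..<?n}"
      then show "coeff f i * w $ i = coeff f i * x ^ i * w $ 0"
        using wj[of i] by simp
    qed simp
    finally have "poly f x * w $ 0 = 0" 
      by (simp add: poly distrib_right neg_eq_iff_add_eq_0)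
    with \<open>w $ 0 \<noteq> 0\<close> show "poly f x = 0" by simp
  next
    assume root: "poly f x = 0"
    define w where "w = vec ?n (\<lambda>i. x ^ i)"
    have w: "w \<in> carrier_vec ?n" by (simp add: w_def)
    have "?C\<^sup>T *\<^sub>v w = x \<cdot>\<^sub>v w"
    proof (rule eq_vecI)
      fix j assume "j < dim_vec (x \<cdot>\<^sub>v w)"
      then have j: "j < ?n" by (simp add: w_def)
      have "(\<Sum>i<?n. coeff f i * w $ i) = (\<Sum>i<?n. coeff f i * x ^ i)"
        by (simp add: w_def)
      with root poly have "- (\<Sum>i<?n. coeff f i * w $ i) = x ^ ?n"
        by (simp add: add_eq_0_iff)
      then show "(?C\<^sup>T *\<^sub>v w) $ j = (x \<cdot>\<^sub>v w) $ j"
        using index_transpose_companion_mat_mult_vec[OF w j] j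
        by (cases "Suc j = ?n") (simp_all add: w_def power_Suc[symmetric] del: power_Suc)
    qed (simp add: w_def companion_mat_def)
    moreover have "w \<noteq> 0\<^sub>v ?n"
    proof
      assume "w = 0\<^sub>v ?n"
      then have "w $ 0 = 0" using deg by simp
      then show False using deg by (simp add: w_def)
    qed
    ultimately show "eigenvalue ?C\<^sup>T x"
      using w companion_mat_carrier[of f] by (auto simp: eigenvalue_def eigenvector_def)
  qed
  then show ?thesis using eigenvalue_transpose_mat[OF companion_mat_carrier] by blast
qed

section \<open>Complex coefficients and reversal\<close>

lemma map_mat_companion_mat:
  "map_mat complex_of_real (companion_mat f) = companion_mat (map_poly complex_of_real f)"
  by (auto intro!: eq_matI simp: companion_mat_def coeff_map_poly)

lemma map_poly_monic_reversal:
  "map_poly complex_of_real (monic_reversal f) = monic_reversal (map_poly complex_of_real f)"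
  by (rule poly_eqI) (simp add: monic_reversal_def coeff_map_poly coeff_reflect_poly)

lemma degree_monic_reversal: "coeff f 0 \<noteq> 0 \<Longrightarrow> degree (monic_reversal f) = degree f"
  by (simp add: monic_reversal_def)

lemma lead_coeff_monic_reversal: "coeff f 0 \<noteq> 0 \<Longrightarrow> lead_coeff (monic_reversal f) = 1"
  by (simp add: degree_monic_reversal) (simp add: monic_reversal_def coeff_reflect_poly)

text \<open>Away from 0 the reversal is \<open>x ^ degree f * poly f (inverse x)\<close> up to a
  nonzero constant; at 0 it takes the value \<open>lead_coeff f / coeff f 0\<close>, which is
  nonzero.\<close>

lemma poly_monic_reversal_eq_0_iff:
  assumes "coeff f 0 \<noteq> 0"
  shows "poly (monic_reversal f) x = 0 \<longleftrightarrow> x \<noteq> 0 \<and> poly f (inverse x) = 0"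
proof (cases "x = 0")
  case True
  have "lead_coeff f \<noteq> 0" using assms by auto
  then show ?thesis using True assms by (simp add: monic_reversal_def poly_0_coeff_0)
qed (use assms in \<open>simp add: monic_reversal_def poly_reflect_poly_nz\<close>)

section \<open>Limits for companion matrices\<close>

lemma root_norm_pow_companion_mat_tendsto:
  assumes N: "matrix_norm n N" and monic: "lead_coeff f = 1" and deg: "degree f = n" and n: "n > 0"
    and x: "poly f x = 0" and max: "\<And>y. poly f y = 0 \<Longrightarrow> cmod y \<le> cmod x"
  shows "(\<lambda>k. root k (N (companion_mat f ^\<^sub>m k))) \<longlonglongrightarrow> cmod x"
proof -
  let ?C = "companion_mat f"
  have C: "?C \<in> carrier_mat n n" using companion_mat_carrier[of f] deg by simp
  have spec: "spectrum ?C = {y. poly f y = 0}"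
    using eigenvalue_companion_mat[OF monic] deg n by (auto simp: spectrum_def)
  \<comment> \<open>The spectral radius is attained at some root \<open>y\<close>, hence is at most
    \<open>cmod x\<close>; it is at least \<open>cmod x\<close> because \<open>x\<close> itself is
    in the spectrum.\<close>
  have "cmod x \<in> cmod ` spectrum ?C" using x spec by auto
  moreover obtain y where "poly f y = 0" "spectral_radius ?C = cmod y"
    using spectral_radius_mem_max(1)[OF C n] spec by auto
  ultimately have "spectral_radius ?C = cmod x"
    using spectral_radius_mem_max(2)[OF C n] max by (simp add: order_antisym)
  with gelfand_formula[OF N C n] show ?thesis by simp
qed

theorem theorem2p3:
  fixes n :: nat and p :: "real poly" and l :: "nat \<Rightarrow> complex"
    and N :: "complex mat \<Rightarrow> real" and C1 C2 :: "complex mat"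
  assumes "n \<ge> 2"
    and "degree p = n" and "lead_coeff p = 1" and "coeff p 0 \<noteq> 0"
    and "image_mset l (mset_set {1..n}) = proots (map_poly complex_of_real p)"
    and "\<And>i j. 1 \<le> i \<Longrightarrow> i \<le> j \<Longrightarrow> j \<le> n \<Longrightarrow> cmod (l i) \<le> cmod (l j)"
    and "C1 = map_mat complex_of_real (companion_mat p)"
    and "C2 = map_mat complex_of_real (companion_mat (monic_reversal p))"
    and "matrix_norm n N"
  shows "(\<lambda>k. root k (N (C1 ^\<^sub>m k))) \<longlonglongrightarrow> cmod (l n)
       \<and> (\<lambda>k. root k (N (C2 ^\<^sub>m k))) \<longlonglongrightarrow> 1 / cmod (l 1)"
proof -
  \<comment> \<open>The roots are complex, so the argument runs over \<open>P\<close>; forming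
    companion matrices and reversals commutes with the embedding of the reals.\<close>
  define P where "P = map_poly complex_of_real p"
  have P: "degree P = n" "lead_coeff P = 1" "coeff P 0 \<noteq> 0"
    using assms(2-4) by (simp_all add: P_def coeff_map_poly)
  have "P \<noteq> 0" using P(3) by auto
  \<comment> \<open>Passing to \<open>set_mset\<close> forgets multiplicities: the spectral radius
    depends only on the set of roots.\<close>
  have roots: "{x. poly P x = 0} = l ` {1..n}"
    using arg_cong[OF assms(5), of set_mset] \<open>P \<noteq> 0\<close> by (simp flip: P_def)
  have root: "poly P (l i) = 0" if "1 \<le> i" "i \<le> n" for i
    using roots that by auto
  have nz: "x \<noteq> 0" if "poly P x = 0" for x
    using that P(3) by (auto simp: poly_0_coeff_0)
  have bounds: "cmod (l 1) \<le> cmod x \<and> cmod x \<le> cmod (l n)" if "poly P x = 0" for x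
  proof -
    obtain i where "1 \<le> i" "i \<le> n" "x = l i"
      using \<open>poly P x = 0\<close> roots[THEN eqset_imp_iff, of x] by auto
    then show ?thesis using assms(6)[of 1 i] assms(6)[of i n] by simp
  qed
  have "(\<lambda>k. root k (N (companion_mat P ^\<^sub>m k))) \<longlonglongrightarrow> cmod (l n)"
    using assms(1) P root bounds
    by (intro root_norm_pow_companion_mat_tendsto[OF assms(9)]) auto
  moreover have "(\<lambda>k. root k (N (companion_mat (monic_reversal P) ^\<^sub>m k))) \<longlonglongrightarrow> cmod (inverse (l 1))"
  proof (rule root_norm_pow_companion_mat_tendsto[OF assms(9)])
    show "lead_coeff (monic_reversal P) = 1" "degree (monic_reversal P) = n"
      using lead_coeff_monic_reversal[OF P(3)] degree_monic_reversal[OF P(3)] P(1) by simp_all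
    show "n > 0" using assms(1) by simp
    have l1: "poly P (l 1) = 0" using root assms(1) by simp
    then show "poly (monic_reversal P) (inverse (l 1)) = 0"
      using nz P(3) by (simp add: poly_monic_reversal_eq_0_iff)
    \<comment> \<open>Inversion reverses the order of moduli: \<open>inverse y\<close> is a root of
      \<open>P\<close>, so its modulus is at least that of \<open>l 1\<close>, which is nonzero
      because \<open>coeff P 0\<close> is.\<close>
    fix y assume "poly (monic_reversal P) y = 0"
    then have y: "y \<noteq> 0" "poly P (inverse y) = 0"
      using P(3) by (simp_all add: poly_monic_reversal_eq_0_iff)
    have "cmod (l 1) > 0" using nz[OF l1] by simp
    moreover have "cmod (l 1) \<le> inverse (cmod y)" using bounds[OF y(2)] by (simp add: norm_inverse)
    ultimately show "cmod y \<le> cmod (inverse (l 1))"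
      using le_imp_inverse_le by (fastforce simp: norm_inverse)
  qed
  ultimately show ?thesis
    using assms(7,8)
    by (simp add: map_mat_companion_mat map_poly_monic_reversal norm_divide inverse_eq_divide flip: P_def)
qed

end
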